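(* Let $X$ be an infinite-dimensional complex Banach space and $T\in L(X)$ be such that $\sigma_{su}(T)=\partial\sigma(T)$ and no point of $\partial\sigma(T)$ is isolated in $\sigma(T)$. Then $$\sigma_{ec}(T)\subset\sigma_{su}(T)=\sigma_{gKR}(T)=\sigma_{gK}(T)=\sigma_{Kt}(T)=\sigma_{eK}(T)=\sigma_K(T)=\sigma_{\mathbf{gDR}\mathcal Q}(T).$$
   Context: $\sigma_{su}(T)$ is the set of $\lambda$ with $T-\lambda$ not surjective; $\sigma_{ec}(T)=\{\lambda: R(T-\lambda)\text{ not closed}\}$. $S$ is Kato if $R(S)$ is closed and $N(S)\subset R(S^n)$ for all $n$; $S$ is Riesz if $S-\lambda$ is Fredholm for all $\lambda\ne0$. For an operator $S$ and closed $S$-invariant $M,N$ with $X=M\oplus N$ and $S_M$ Kato: if $S_N$ is Riesz, $S$ admits a GKRD; if $S_N$ is quasinilpotent, a GKD; if $S_N$ is nilpotent, $S$ is of Kato type; if $N$ is finite-dimensional and $S_N$ nilpotent, $S$ is essentially Kato. $\sigma_{gKR}$, $\sigma_{gK}$, $\sigma_{Kt}$, $\sigma_{eK}$, $\sigma_K$: sets of $\lambda$ with $T-\lambda$ not admitting a GKRD, not admitting a GKD, not of Kato type, not essentially Kato, not Kato. $\sigma_{\mathbf{gDR}\mathcal Q}(T)$ is the set of $\lambda$ for which there are no closed $(T-\lambda)$-invariant $M,N$ with $X=M\oplus N$, $(T-\lambda)_M$ surjective and $(T-\lambda)_N$ Riesz. *)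

theory Defs
  imports "HOL-Analysis.Analysis"
begin

class complex_banach = banach +
  fixes cscale :: "complex \<Rightarrow> 'a \<Rightarrow> 'a"
  assumes cscale_add_right: "cscale a (x + y) = cscale a x + cscale a y"
    and cscale_add_left: "cscale (a + b) x = cscale a x + cscale b x"
    and cscale_cscale: "cscale a (cscale b x) = cscale (a * b) x"
    and cscale_one: "cscale 1 x = x"
    and cscale_of_real: "cscale (complex_of_real r) x = scaleR r x"
    and norm_cscale: "norm (cscale a x) = cmod a * norm x"

definition cblinear :: "('a::complex_banach \<Rightarrow> 'a) \<Rightarrow> bool" where
  "cblinear S \<longleftrightarrow> bounded_linear S \<and> (\<forall>c x. S (cscale c x) = cscale c (S x))"

definition cspan :: "'a::complex_banach set \<Rightarrow> 'a set" where
  "cspan A = {x. \<exists>F c. finite F \<and> F \<subseteq> A \<and> x = (\<Sum>v\<in>F. cscale (c v) v)}"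

definition fin_dim_c :: "'a::complex_banach set \<Rightarrow> bool" where
  "fin_dim_c N \<longleftrightarrow> (\<exists>F. finite F \<and> F \<subseteq> N \<and> N \<subseteq> cspan F)"

definition closed_csubspace :: "'a::complex_banach set \<Rightarrow> bool" where
  "closed_csubspace M \<longleftrightarrow> closed M \<and> 0 \<in> M \<and> (\<forall>x\<in>M. \<forall>y\<in>M. x + y \<in> M)
     \<and> (\<forall>c. \<forall>x\<in>M. cscale c x \<in> M)"

definition opshift :: "('a::complex_banach \<Rightarrow> 'a) \<Rightarrow> complex \<Rightarrow> 'a \<Rightarrow> 'a" where
  "opshift S z = (\<lambda>x. S x - cscale z x)"

text \<open>Spectrum: S - z is not invertible in L(X) (equivalently, by the open mapping theorem,
not bijective).\<close>
definition cspectrum :: "('a::complex_banach \<Rightarrow> 'a) \<Rightarrow> complex set" where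
  "cspectrum S = {z. \<not> bij (opshift S z)}"

text \<open>Notions for the restriction S_M of S to a closed S-invariant subspace M.\<close>

definition kato_on :: "('a::complex_banach \<Rightarrow> 'a) \<Rightarrow> 'a set \<Rightarrow> bool" where
  "kato_on S M \<longleftrightarrow> closed (S ` M) \<and> (\<forall>n. {x\<in>M. S x = 0} \<subseteq> (S ^^ n) ` M)"

definition fredholm_on :: "('a::complex_banach \<Rightarrow> 'a) \<Rightarrow> 'a set \<Rightarrow> bool" where
  "fredholm_on S N \<longleftrightarrow> closed (S ` N) \<and> fin_dim_c {x\<in>N. S x = 0}
     \<and> (\<exists>F. finite F \<and> F \<subseteq> N \<and> N = {y + S w | y w. y \<in> cspan F \<and> w \<in> N})"

definition riesz_on :: "('a::complex_banach \<Rightarrow> 'a) \<Rightarrow> 'a set \<Rightarrow> bool" where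
  "riesz_on S N \<longleftrightarrow> (\<forall>z. z \<noteq> 0 \<longrightarrow> fredholm_on (opshift S z) N)"

definition quasinilpotent_on :: "('a::complex_banach \<Rightarrow> 'a) \<Rightarrow> 'a set \<Rightarrow> bool" where
  "quasinilpotent_on S N \<longleftrightarrow> (\<forall>z. z \<noteq> 0 \<longrightarrow> bij_betw (opshift S z) N N)"

definition nilpotent_on :: "('a::complex_banach \<Rightarrow> 'a) \<Rightarrow> 'a set \<Rightarrow> bool" where
  "nilpotent_on S N \<longleftrightarrow> (\<exists>n. \<forall>x\<in>N. (S ^^ n) x = 0)"

definition surjective_on :: "('a::complex_banach \<Rightarrow> 'a) \<Rightarrow> 'a set \<Rightarrow> bool" where
  "surjective_on S M \<longleftrightarrow> S ` M = M"

definition reducing_pair :: "('a::complex_banach \<Rightarrow> 'a) \<Rightarrow> 'a set \<Rightarrow> 'a set \<Rightarrow> bool" where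
  "reducing_pair S M N \<longleftrightarrow> closed_csubspace M \<and> closed_csubspace N
     \<and> S ` M \<subseteq> M \<and> S ` N \<subseteq> N \<and> M \<inter> N = {0}
     \<and> (\<forall>x. \<exists>m\<in>M. \<exists>n\<in>N. x = m + n)"

definition is_kato :: "('a::complex_banach \<Rightarrow> 'a) \<Rightarrow> bool" where
  "is_kato S \<longleftrightarrow> kato_on S UNIV"

definition admits_GKRD :: "('a::complex_banach \<Rightarrow> 'a) \<Rightarrow> bool" where
  "admits_GKRD S \<longleftrightarrow> (\<exists>M N. reducing_pair S M N \<and> kato_on S M \<and> riesz_on S N)"

definition admits_GKD :: "('a::complex_banach \<Rightarrow> 'a) \<Rightarrow> bool" where
  "admits_GKD S \<longleftrightarrow> (\<exists>M N. reducing_pair S M N \<and> kato_on S M \<and> quasinilpotent_on S N)"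

definition kato_type :: "('a::complex_banach \<Rightarrow> 'a) \<Rightarrow> bool" where
  "kato_type S \<longleftrightarrow> (\<exists>M N. reducing_pair S M N \<and> kato_on S M \<and> nilpotent_on S N)"

definition essentially_kato :: "('a::complex_banach \<Rightarrow> 'a) \<Rightarrow> bool" where
  "essentially_kato S \<longleftrightarrow> (\<exists>M N. reducing_pair S M N \<and> kato_on S M \<and> fin_dim_c N
      \<and> nilpotent_on S N)"

definition admits_gDRQ :: "('a::complex_banach \<Rightarrow> 'a) \<Rightarrow> bool" where
  "admits_gDRQ S \<longleftrightarrow> (\<exists>M N. reducing_pair S M N \<and> surjective_on S M \<and> riesz_on S N)"

definition sigma_su :: "('a::complex_banach \<Rightarrow> 'a) \<Rightarrow> complex set" where
  "sigma_su T = {z. range (opshift T z) \<noteq> UNIV}"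
definition sigma_ec :: "('a::complex_banach \<Rightarrow> 'a) \<Rightarrow> complex set" where
  "sigma_ec T = {z. \<not> closed (range (opshift T z))}"
definition sigma_gKR :: "('a::complex_banach \<Rightarrow> 'a) \<Rightarrow> complex set" where
  "sigma_gKR T = {z. \<not> admits_GKRD (opshift T z)}"
definition sigma_gK :: "('a::complex_banach \<Rightarrow> 'a) \<Rightarrow> complex set" where
  "sigma_gK T = {z. \<not> admits_GKD (opshift T z)}"
definition sigma_Kt :: "('a::complex_banach \<Rightarrow> 'a) \<Rightarrow> complex set" where
  "sigma_Kt T = {z. \<not> kato_type (opshift T z)}"
definition sigma_eK :: "('a::complex_banach \<Rightarrow> 'a) \<Rightarrow> complex set" where
  "sigma_eK T = {z. \<not> essentially_kato (opshift T z)}"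
definition sigma_K :: "('a::complex_banach \<Rightarrow> 'a) \<Rightarrow> complex set" where
  "sigma_K T = {z. \<not> is_kato (opshift T z)}"
definition sigma_gDRQ :: "('a::complex_banach \<Rightarrow> 'a) \<Rightarrow> complex set" where
  "sigma_gDRQ T = {z. \<not> admits_gDRQ (opshift T z)}"

end

theory Submission
  imports Defs
begin

text \<open>
  Only the inclusion \<open>\<partial>\<sigma>(T) \<subseteq> \<sigma>\<^sub>g\<^sub>K\<^sub>R(T)\<close> needs analysis. Suppose that \<open>\<lambda> \<in> \<partial>\<sigma>(T)\<close> and that \<open>T - \<lambda>\<close> is
  the direct sum of a Kato part on \<open>M\<close> and a Riesz part on \<open>N\<close>. If \<open>A\<close> maps a closed subspace \<open>W\<close>
  onto itself, then triviality of the kernel of \<open>A - z\<close> on \<open>W\<close> does not depend on \<open>z\<close> near \<open>0\<close>. The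
  generalized range \<open>\<Inter>\<^sub>n R(A\<^sup>n)\<close> is such a \<open>W\<close> if \<open>A\<close> is Kato or Fredholm, and it contains the kernel
  of \<open>A\<close> in the Kato case and that of \<open>A - z\<close> for every \<open>z \<noteq> 0\<close>. In the Kato case this makes the
  part on \<open>M\<close> invertible at \<open>\<lambda>\<close>, hence near \<open>\<lambda>\<close>. Since \<open>\<lambda>\<close> is not isolated in \<open>\<sigma>(T)\<close>, there is some
  \<open>\<mu> \<in> \<partial>\<sigma>(T)\<close> close to but different from \<open>\<lambda>\<close>, and in the same way some \<open>\<nu> \<in> \<partial>\<sigma>(T)\<close> close to but
  different from \<open>\<mu>\<close>. The Fredholm case at \<open>\<mu>\<close> shows that \<open>T - \<nu>\<close> is injective on \<open>N\<close>; its range there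
  is closed, so as a boundary point \<open>\<nu>\<close> would lie in the resolvent set, a contradiction.
\<close>

section \<open>Closed ranges in Banach spaces\<close>

text \<open>Each approximate preimage leaves a residual in \<open>V\<close> that is smaller by the
  factor \<open>q\<close>. Correcting residual after residual gives an absolutely convergent series
  of preimages, bounded by the geometric series with sum \<open>C / (1 - q)\<close>; closedness of
  \<open>Y\<close> keeps its sum in \<open>Y\<close>.\<close>

lemma successive_approximation:
  fixes B :: "'a::banach \<Rightarrow> 'b::real_normed_vector"
  assumes B: "bounded_linear B" and Y: "subspace Y" "closed Y"
    and q: "0 \<le> q" "q < 1" and C: "0 \<le> C"
    and approx: "\<And>y. y \<in> V \<Longrightarrow>
      \<exists>x\<in>Y. norm x \<le> C * norm y \<and> y - B x \<in> V \<and> norm (y - B x) \<le> q * norm y"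
    and y: "y \<in> V"
  shows "\<exists>x\<in>Y. B x = y \<and> norm x \<le> C / (1 - q) * norm y"
proof -
  interpret B: bounded_linear B by fact
  obtain g where g: "\<And>y. y \<in> V \<Longrightarrow> g y \<in> Y \<and> norm (g y) \<le> C * norm y \<and>
      y - B (g y) \<in> V \<and> norm (y - B (g y)) \<le> q * norm y"
    using approx by metis
  \<comment> \<open>\<open>r n\<close> is the residual after \<open>n\<close> corrections, so the
    partial sums of \<open>g (r i)\<close> have image \<open>y - r n\<close>.\<close>
  define r where "r n = ((\<lambda>y. y - B (g y)) ^^ n) y" for n
  have r_Suc: "r (Suc n) = r n - B (g (r n))" for n by (simp add: r_def)
  have r: "r n \<in> V \<and> norm (r n) \<le> q ^ n * norm y" for n
  proof (induction n)
    case 0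
    then show ?case using y by (simp add: r_def)
  next
    case (Suc n)
    have "norm (r (Suc n)) \<le> q * norm (r n)" using g Suc r_Suc by simp
    also have "\<dots> \<le> q * (q ^ n * norm y)" using Suc q by (intro mult_left_mono) auto
    finally show ?case using g Suc r_Suc by (simp add: mult.assoc)
  qed
  have nx: "norm (g (r n)) \<le> C * norm y * q ^ n" for n
  proof -
    have "norm (g (r n)) \<le> C * norm (r n)" using g r by blast
    also have "\<dots> \<le> C * (q ^ n * norm y)" using r C by (intro mult_left_mono) auto
    finally show ?thesis by (simp add: mult_ac)
  qed
  have sg: "summable (\<lambda>n. C * norm y * q ^ n)"
    using q by (intro summable_mult summable_geometric) auto
  have sm: "summable (\<lambda>n. g (r n))"
    by (rule summable_comparison_test'[OF sg, of 0]) (use nx in auto)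
  let ?x = "\<Sum>n. g (r n)"
  have lim: "(\<lambda>n. \<Sum>i<n. g (r i)) \<longlonglongrightarrow> ?x"
    using sm by (rule summable_LIMSEQ)
  have "(\<Sum>i<n. g (r i)) \<in> Y" for n
    using g r Y(1) by (intro subspace_sum) auto
  then have xY: "?x \<in> Y"
    using closed_sequentially[OF Y(2) _ lim] by simp
  have part: "B (\<Sum>i<n. g (r i)) = y - r n" for n
  proof (induction n)
    case 0
    then show ?case by (simp add: r_def B.zero)
  next
    case (Suc n)
    then show ?case by (simp add: r_Suc B.add)
  qed
  have "(\<lambda>n. norm y * q ^ n) \<longlonglongrightarrow> 0"
    using q by (intro tendsto_mult_right_zero LIMSEQ_power_zero) auto
  then have "r \<longlonglongrightarrow> 0"
    by (rule Lim_null_comparison[rotated]) (use r in \<open>auto simp: mult_ac\<close>)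
  then have "(\<lambda>n. B (\<Sum>i<n. g (r i))) \<longlonglongrightarrow> y - 0"
    unfolding part by (intro tendsto_diff tendsto_const)
  moreover have "(\<lambda>n. B (\<Sum>i<n. g (r i))) \<longlonglongrightarrow> B ?x"
    by (rule B.tendsto[OF lim])
  ultimately have "B ?x = y" using LIMSEQ_unique by fastforce
  moreover have "norm ?x \<le> (\<Sum>n. C * norm y * q ^ n)"
    using norm_suminf_le[OF nx sg] .
  then have "norm ?x \<le> C / (1 - q) * norm y"
    using q by (simp add: suminf_mult summable_geometric suminf_geometric)
  ultimately show ?thesis using xY by blast
qed

text \<open>This moves a ball found around some point \<open>y0\<close> by a category argument to
  the origin, at the price of adding the two radii.\<close>

lemma closure_image_diff:
  fixes B :: "'a::real_normed_vector \<Rightarrow> 'b::real_normed_vector"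
  assumes "bounded_linear B" "subspace Y"
    and "a \<in> closure (B ` (Y \<inter> cball 0 s))" "b \<in> closure (B ` (Y \<inter> cball 0 t))"
  shows "a - b \<in> closure (B ` (Y \<inter> cball 0 (s + t)))"
proof -
  interpret B: bounded_linear B by fact
  obtain u where u: "\<And>n. u n \<in> B ` (Y \<inter> cball 0 s)" "u \<longlonglongrightarrow> a"
    using assms(3) closure_sequential by blast
  obtain v where v: "\<And>n. v n \<in> B ` (Y \<inter> cball 0 t)" "v \<longlonglongrightarrow> b"
    using assms(4) closure_sequential by blast
  have "u n - v n \<in> B ` (Y \<inter> cball 0 (s + t))" for n
  proof -
    obtain x y where xy: "x \<in> Y" "norm x \<le> s" "u n = B x" "y \<in> Y" "norm y \<le> t" "v n = B y"
      using u(1)[of n] v(1)[of n] by auto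
    have "norm (x - y) \<le> s + t" using xy norm_triangle_ineq4[of x y] by linarith
    then show ?thesis
      using xy assms(2) by (intro image_eqI[of _ _ "x - y"]) (auto simp: B.diff subspace_diff)
  qed
  moreover have "(\<lambda>n. u n - v n) \<longlonglongrightarrow> a - b"
    using u v by (intro tendsto_diff)
  ultimately show ?thesis by (auto simp: closure_sequential intro!: exI[of _ "\<lambda>n. u n - v n"])
qed

text \<open>The open mapping theorem, relative to a closed subspace: Baire category gives approximate
  preimages of controlled norm, which are corrected by successive approximation.\<close>

lemma closed_range_lift:
  fixes B :: "'a::banach \<Rightarrow> 'b::banach"
  assumes B: "bounded_linear B" and Y: "subspace Y" "closed Y" and cl: "closed (B ` Y)"
  obtains C where "C > 0" "\<And>y. y \<in> B ` Y \<Longrightarrow> \<exists>x\<in>Y. B x = y \<and> norm x \<le> C * norm y"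
proof -
  interpret B: bounded_linear B by fact
  let ?V = "B ` Y"
  have V: "subspace ?V" using Y(1) B.linear_axioms linear_subspace_image by blast
  define K where "K n = closure (B ` (Y \<inter> cball 0 (real n)))" for n :: nat
  have KV: "K n \<subseteq> ?V" for n
    unfolding K_def by (rule closure_minimal) (use cl in auto)
  have UK: "(\<Union>n. K n) = ?V"
  proof
    show "(\<Union>n. K n) \<subseteq> ?V" using KV by blast
    show "?V \<subseteq> (\<Union>n. K n)"
    proof
      fix y assume "y \<in> ?V"
      then obtain x where x: "x \<in> Y" "y = B x" by auto
      obtain n where "norm x \<le> real n" using real_arch_simple by blast
      then have "y \<in> B ` (Y \<inter> cball 0 (real n))" using x by auto
      then show "y \<in> (\<Union>n. K n)" unfolding K_def using closure_subset by fast
    qed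
  qed
  let ?X = "top_of_set ?V"
  have cm: "completely_metrizable_space ?X"
    using cl closed_closedin completely_metrizable_space_closedin
      completely_metrizable_space_euclidean by blast
  have "\<exists>n. ?X interior_of (K n) \<noteq> {}"
  proof (rule ccontr)
    assume "\<not> (\<exists>n. ?X interior_of (K n) \<noteq> {})"
    then have "?X interior_of (\<Union>(range K)) = {}"
      using cm KV by (intro Baire_category_alt) (auto simp: K_def closed_subset)
    then show False using UK V by (auto simp: interior_of_topspace[of ?X, simplified] dest: subspace_0)
  qed
  then obtain n y0 where "y0 \<in> ?X interior_of (K n)" by auto
  then obtain U where U: "openin ?X U" "y0 \<in> U" "U \<subseteq> K n"
    by (auto simp: interior_of_def)
  then obtain d where d: "d > 0" "ball y0 d \<inter> ?V \<subseteq> U"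
    by (metis openin_contains_ball)
  have y0: "y0 \<in> ?V" "y0 \<in> K n" using U KV by auto
  \<comment> \<open>Write \<open>y\<close> as \<open>(y0 + y) - y0\<close>, where both terms lie in
    \<open>K n\<close>.\<close>
  have small: "y \<in> closure (B ` (Y \<inter> cball 0 (2 * real n)))" if "y \<in> ?V" "norm y < d" for y
  proof -
    have "y0 + y \<in> ?V" using y0 that V subspace_add by blast
    moreover have "y0 + y \<in> ball y0 d" using that by (simp add: dist_norm)
    ultimately have "y0 + y \<in> K n" using d U by blast
    from closure_image_diff[OF B Y(1) this[unfolded K_def] y0(2)[unfolded K_def]]
    show ?thesis by simp
  qed
  \<comment> \<open>Scaling \<open>y\<close> by \<open>t = d / (2 * norm y)\<close> gives norm
    \<open>d / 2\<close>, inside the ball of \<open>small\<close>. Undoing the scaling turns the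
    bound \<open>2 * n\<close> on the preimage into \<open>4 * n / d * norm y\<close> and the error
    \<open>d / 4\<close> into \<open>norm y / 2\<close>. The summand 1 keeps \<open>C\<close>
    positive.\<close>
  define C where "C = 4 * (real n + 1) / d"
  have C0: "C > 0" using d by (simp add: C_def)
  have approx: "\<exists>x\<in>Y. norm x \<le> C * norm y \<and> y - B x \<in> ?V \<and> norm (y - B x) \<le> 1/2 * norm y"
    if y: "y \<in> ?V" for y
  proof (cases "y = 0")
    case True
    then show ?thesis using Y(1) V by (intro bexI[of _ 0]) (auto simp: B.zero subspace_0)
  next
    case False
    define t where "t = d / (2 * norm y)"
    have t: "t > 0" using d False by (simp add: t_def)
    have "t *\<^sub>R y \<in> ?V" using y V subspace_scale by blast
    moreover have "norm (t *\<^sub>R y) < d" using d False by (simp add: t_def)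
    ultimately have "t *\<^sub>R y \<in> closure (B ` (Y \<inter> cball 0 (2 * real n)))" by (rule small)
    moreover have "d / 4 > 0" using d by simp
    ultimately obtain b where b: "b \<in> B ` (Y \<inter> cball 0 (2 * real n))" "dist b (t *\<^sub>R y) < d / 4"
      unfolding closure_approachable by blast
    then obtain x where x: "x \<in> Y" "norm x \<le> 2 * real n" "dist (B x) (t *\<^sub>R y) < d / 4"
      by auto
    let ?x = "(1 / t) *\<^sub>R x"
    have "norm ?x \<le> 1 / t * (2 * real n)" using x(2) t by (simp add: divide_right_mono)
    also have "\<dots> \<le> C * norm y"
      using d False by (simp add: t_def C_def field_simps)
    finally have 1: "norm ?x \<le> C * norm y" .
    have "y - B ?x = (1 / t) *\<^sub>R (t *\<^sub>R y - B x)"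
      using t by (simp add: B.scaleR scaleR_diff_right)
    then have "norm (y - B ?x) = 1 / t * dist (B x) (t *\<^sub>R y)"
      using t by (simp add: dist_norm norm_minus_commute)
    also have "\<dots> \<le> 1 / t * (d / 4)" using x(3) t by (intro mult_left_mono) auto
    also have "\<dots> = 1/2 * norm y" using d False by (simp add: t_def)
    finally have 2: "norm (y - B ?x) \<le> 1/2 * norm y" .
    have 3: "?x \<in> Y" using x(1) Y(1) subspace_scale by blast
    then have "y - B ?x \<in> ?V" using y V by (intro subspace_diff) auto
    then show ?thesis using 1 2 3 by blast
  qed
  show ?thesis
  \<comment> \<open>With contraction factor 1/2 the geometric series contributes
    \<open>1 / (1 - 1/2) = 2\<close>.\<close>
  proof (rule that[of "2 * C"])
    show "2 * C > 0" using C0 by simp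
    fix y assume "y \<in> ?V"
    from successive_approximation[OF B Y _ _ _ approx this] C0
    show "\<exists>x\<in>Y. B x = y \<and> norm x \<le> 2 * C * norm y" by auto
  qed
qed

text \<open>Since \<open>V\<close> contains the kernel, whether a point of \<open>Y\<close> lies in
  \<open>V\<close> can be read off from its image. A limit of images has a preimage \<open>x\<close>
  in \<open>Y\<close>, and lifts of controlled norm exhibit \<open>x\<close> as a limit of points of
  \<open>V\<close>.\<close>

lemma closed_image_closed_subspace:
  fixes B :: "'a::banach \<Rightarrow> 'b::banach"
  assumes B: "bounded_linear B" and Y: "subspace Y" "closed Y" and cl: "closed (B ` Y)"
    and V: "subspace V" "closed V" "V \<subseteq> Y" and ker: "{x\<in>Y. B x = 0} \<subseteq> V"
  shows "closed (B ` V)"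
proof -
  interpret B: bounded_linear B by fact
  obtain C where C: "C > 0" "\<And>y. y \<in> B ` Y \<Longrightarrow> \<exists>x\<in>Y. B x = y \<and> norm x \<le> C * norm y"
    using closed_range_lift[OF B Y cl] by metis
  show ?thesis unfolding closed_sequential_limits
  proof (intro allI impI, elim conjE)
    fix f l assume f: "\<forall>n. f n \<in> B ` V" "f \<longlonglongrightarrow> l"
    then obtain v where v: "\<And>n. v n \<in> V" "\<And>n. f n = B (v n)" by (auto simp: image_iff) metis
    have "\<forall>n. f n \<in> B ` Y" using f V by blast
    then have "l \<in> B ` Y" using closed_sequentially[OF cl _ f(2)] by blast
    then obtain x where x: "x \<in> Y" "l = B x" by blast
    have "f n - l \<in> B ` Y" for n
      using v[of n] x V(3) Y(1) by (intro image_eqI[of _ _ "v n - x"]) (auto simp: B.diff subspace_diff)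
    then have "\<exists>u\<in>Y. B u = f n - l \<and> norm u \<le> C * norm (f n - l)" for n using C by blast
    then obtain u where u: "\<And>n. u n \<in> Y" "\<And>n. B (u n) = f n - l"
      "\<And>n. norm (u n) \<le> C * norm (f n - l)" by metis
    have "(\<lambda>n. C * norm (f n - l)) \<longlonglongrightarrow> C * norm (l - l)"
      by (intro tendsto_intros f)
    then have u0: "u \<longlonglongrightarrow> 0"
      by (intro Lim_null_comparison[of u "\<lambda>n. C * norm (f n - l)"]) (use u in auto)
    \<comment> \<open>\<open>x + u n\<close> and \<open>v n\<close> have the same image
      \<open>f n\<close>, so they differ by a kernel element.\<close>
    have xu: "x + u n \<in> V" for n
    proof -
      have "x + u n - v n \<in> {x\<in>Y. B x = 0}"
        using x u v[of n] Y V by (auto simp: B.add B.diff subspace_add subspace_diff subsetD)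
      then have "x + u n - v n \<in> V" using ker by blast
      then have "(x + u n - v n) + v n \<in> V" using v V subspace_add by blast
      then show ?thesis by simp
    qed
    have "(\<lambda>n. x + u n) \<longlonglongrightarrow> x + 0" by (intro tendsto_intros u0)
    then have "x \<in> V" using closed_sequentially[OF V(2), of "\<lambda>n. x + u n"] xu by auto
    then show "l \<in> B ` V" using x by blast
  qed
qed

section \<open>Finite extensions and descending chains of subspaces\<close>

text \<open>For \<open>a\<close> outside the closed span, its positive distance \<open>d\<close> to
  the span controls the coefficient of \<open>a\<close>. The coefficients along a convergent
  sequence are therefore Cauchy, and what remains converges inside the span.\<close>

lemma closed_span_insert:
  fixes V :: "'a::banach set"
  assumes "closed (span V)"
  shows "closed (span (insert a V))"
proof (cases "a \<in> span V")
  case True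
  then show ?thesis using assms by (simp add: span_redundant)
next
  case False
  let ?W = "span V"
  have ne: "?W \<noteq> {}" using span_zero by blast
  define d where "d = infdist a ?W"
  have d: "d > 0"
    using False assms ne in_closed_iff_infdist_zero[of ?W a] infdist_nonneg[of a ?W]
    unfolding d_def by linarith
  have bd: "\<bar>k\<bar> * d \<le> norm (w + k *\<^sub>R a)" if w: "w \<in> ?W" for k w
  proof (cases "k = 0")
    case False
    have "- ((1 / k) *\<^sub>R w) \<in> ?W" using w span_scale span_neg by blast
    then have "d \<le> dist a (- ((1 / k) *\<^sub>R w))" unfolding d_def by (rule infdist_le)
    then have "\<bar>k\<bar> * d \<le> \<bar>k\<bar> * norm (a + (1 / k) *\<^sub>R w)"
      by (intro mult_left_mono) (auto simp: dist_norm)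
    also have "\<dots> = norm (k *\<^sub>R (a + (1 / k) *\<^sub>R w))" by simp
    also have "\<dots> = norm (w + k *\<^sub>R a)" using False by (simp add: scaleR_add_right add.commute)
    finally show ?thesis .
  qed simp
  show ?thesis unfolding closed_sequential_limits
  proof (intro allI impI, elim conjE)
    fix f l assume f: "\<forall>n. f n \<in> span (insert a V)" "f \<longlonglongrightarrow> l"
    then have "\<exists>k. f n - k *\<^sub>R a \<in> ?W" for n using span_breakdown_eq by blast
    then obtain k where k: "\<And>n. f n - k n *\<^sub>R a \<in> ?W" by metis
    have "Cauchy k" unfolding Cauchy_iff
    proof (intro allI impI)
      fix e :: real assume "e > 0"
      then have "e * d > 0" using d by simp
      then obtain M where M: "\<And>m n. m \<ge> M \<Longrightarrow> n \<ge> M \<Longrightarrow> norm (f m - f n) < e * d"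
        using LIMSEQ_imp_Cauchy[OF f(2)] unfolding Cauchy_iff by blast
      show "\<exists>M. \<forall>m\<ge>M. \<forall>n\<ge>M. norm (k m - k n) < e"
      proof (intro exI allI impI)
        fix m n assume mn: "m \<ge> M" "n \<ge> M"
        have "\<bar>k m - k n\<bar> * d \<le> norm ((f m - k m *\<^sub>R a) - (f n - k n *\<^sub>R a) + (k m - k n) *\<^sub>R a)"
          using span_diff[OF k k] by (rule bd)
        also have "\<dots> = norm (f m - f n)" by (simp add: algebra_simps)
        also have "\<dots> < e * d" using M mn by blast
        finally show "norm (k m - k n) < e" using d by simp
      qed
    qed
    then obtain k0 where k0: "k \<longlonglongrightarrow> k0" using Cauchy_convergent convergent_def by blast
    have "(\<lambda>n. f n - k n *\<^sub>R a) \<longlonglongrightarrow> l - k0 *\<^sub>R a" by (intro tendsto_intros f k0)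
    then have "l - k0 *\<^sub>R a \<in> ?W"
      using closed_sequentially[OF assms, of "\<lambda>n. f n - k n *\<^sub>R a"] k by blast
    then show "l \<in> span (insert a V)" using span_breakdown_eq by blast
  qed
qed

lemma closed_span_Un_finite:
  fixes V :: "'a::banach set"
  assumes "finite F" "subspace V" "closed V"
  shows "closed (span (V \<union> F))"
  using assms(1)
proof (induction F)
  case empty
  then show ?case using assms by (simp add: span_eq_iff[THEN iffD2])
next
  case (insert a F)
  then show ?case using closed_span_insert[of "V \<union> F" a] by simp
qed

text \<open>Choose \<open>n0\<close> where the dimension, as the size of a basis \<open>b n\<close>,
  is least. For later \<open>m\<close> a basis of \<open>K m\<close> extends to one of
  \<open>K n0\<close>, and minimality leaves no room for a proper extension.\<close>

lemma decreasing_subspaces_stabilize: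
  fixes K :: "nat \<Rightarrow> 'a::real_vector set"
  assumes K: "\<And>n. subspace (K n)" "\<And>m n. m \<le> n \<Longrightarrow> K n \<subseteq> K m"
    and F: "finite F" "K 0 \<subseteq> span F"
  shows "\<exists>n0. \<forall>m\<ge>n0. K n0 \<subseteq> K m"
proof -
  have KF: "K n \<subseteq> span F" for n using K(2)[of 0 n] F by auto
  have "\<exists>B. B \<subseteq> K n \<and> independent B \<and> K n \<subseteq> span B" for n
    using maximal_independent_subset[of "K n"] by metis
  then obtain b where b: "\<And>n. b n \<subseteq> K n" "\<And>n. independent (b n)" "\<And>n. K n \<subseteq> span (b n)"
    by metis
  have fin: "finite B" if "independent B" "B \<subseteq> K n" for B n
    using independent_span_bound[OF F(1) that(1)] that(2) KF[of n] by blast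
  obtain n0 where n0: "\<And>m. card (b n0) \<le> card (b m)"
    using ex_has_least_nat[of "\<lambda>_. True" 0 "\<lambda>n. card (b n)"] by auto
  have "K n0 \<subseteq> K m" if "m \<ge> n0" for m
  proof -
    have bm: "b m \<subseteq> K n0" using b(1)[of m] K(2)[OF that] by blast
    obtain B where B: "b m \<subseteq> B" "B \<subseteq> K n0" "independent B" "K n0 \<subseteq> span B"
      using maximal_independent_subset_extend[OF bm b(2)] by metis
    have "card B \<le> card (b n0)"
      using independent_span_bound[of "b n0" B] fin[OF b(2) b(1)] B b(3)[of n0] by blast
    then have "card B \<le> card (b m)" using n0[of m] by linarith
    then have "b m = B" using B(1) fin[OF B(3) B(2)] by (metis card_seteq)
    then show ?thesis using B(4) b(1)[of m] K(1)[of m] span_minimal by blast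
  qed
  then show ?thesis by blast
qed

section \<open>The generalized range\<close>

definition gen_range :: "('a \<Rightarrow> 'a) \<Rightarrow> 'a set \<Rightarrow> 'a set" where
  "gen_range A Y = (\<Inter>n. (A ^^ n) ` Y)"

lemma funpow_image_antimono:
  assumes "A ` Y \<subseteq> Y" "m \<le> n"
  shows "(A ^^ n) ` Y \<subseteq> (A ^^ m) ` Y"
  using assms(2)
proof (induction n rule: dec_induct)
  case (step n)
  have "(A ^^ Suc n) ` Y = (A ^^ n) ` (A ` Y)" by (simp only: funpow_Suc_right image_comp)
  also have "\<dots> \<subseteq> (A ^^ n) ` Y" using assms(1) by blast
  finally show ?case using step by blast
qed simp

text \<open>A point of the generalized range has a preimage in the range of every power, but these
  preimages may vary with the power. Two of them differ by a kernel element, and from the power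
  \<open>n0\<close> on such differences lie in all later ranges, so one preimage serves for all
  powers. The Kato case has \<open>n0 = 0\<close>.\<close>

lemma gen_range_surj:
  fixes A :: "'a::real_vector \<Rightarrow> 'a"
  assumes A: "linear A" and Y: "subspace Y" "A ` Y \<subseteq> Y"
    and stab: "\<And>m. m \<ge> n0 \<Longrightarrow> {x \<in> (A ^^ n0) ` Y. A x = 0} \<subseteq> (A ^^ m) ` Y"
  shows "A ` gen_range A Y = gen_range A Y"
proof
  have pow: "A ` (A ^^ n) ` Y = (A ^^ Suc n) ` Y" for n by (simp add: image_comp)
  show "A ` gen_range A Y \<subseteq> gen_range A Y"
  proof clarify
    fix x assume x: "x \<in> gen_range A Y"
    have "A x \<in> (A ^^ n) ` Y" for n
    proof -
      have "A x \<in> (A ^^ Suc n) ` Y" using x unfolding gen_range_def pow[symmetric] by blast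
      then show ?thesis using funpow_image_antimono[OF Y(2), of n "Suc n"] by auto
    qed
    then show "A x \<in> gen_range A Y" by (simp add: gen_range_def)
  qed
  show "gen_range A Y \<subseteq> A ` gen_range A Y"
  proof
    fix y assume y: "y \<in> gen_range A Y"
    have "y \<in> A ` (A ^^ n) ` Y" for n using y unfolding gen_range_def pow by blast
    then have "\<exists>x. x \<in> (A ^^ n) ` Y \<and> y = A x" for n by blast
    then obtain x where x: "\<And>n. x n \<in> (A ^^ n) ` Y" "\<And>n. y = A (x n)" by metis
    have sub: "subspace ((A ^^ n) ` Y)" for n
    proof (induction n)
      case (Suc n)
      then show ?case unfolding pow[symmetric] using A linear_subspace_image by blast
    qed (use Y in simp)
    \<comment> \<open>The preimage \<open>x n0\<close> is the one that works: it is compared with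
      \<open>x n\<close> for later \<open>n\<close>, while earlier ranges are larger anyway.\<close>
    have "x n0 \<in> (A ^^ n) ` Y" for n
    proof (cases "n \<ge> n0")
      case True
      have "x n \<in> (A ^^ n0) ` Y" using x(1) funpow_image_antimono[OF Y(2) True] by blast
      then have "x n0 - x n \<in> (A ^^ n0) ` Y" using x(1) sub subspace_diff by blast
      moreover have "A (x n0 - x n) = 0" using x(2) A by (metis linear_diff diff_self)
      ultimately have "x n0 - x n \<in> (A ^^ n) ` Y" using stab[OF True] by blast
      then have "(x n0 - x n) + x n \<in> (A ^^ n) ` Y" using x(1) sub subspace_add by blast
      then show ?thesis by simp
    next
      case False
      then show ?thesis using x(1)[of n0] funpow_image_antimono[OF Y(2), of n n0] by auto
    qed
    then show "y \<in> A ` gen_range A Y" using x(2)[of n0] by (auto simp: gen_range_def)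
  qed
qed

section \<open>Complex operators\<close>

lemma bounded_linear_cscale: "bounded_linear (cscale z :: 'a::complex_banach \<Rightarrow> 'a)"
proof (rule bounded_linear_intro[of _ "cmod z"])
  fix r and x :: 'a
  show "cscale z (r *\<^sub>R x) = r *\<^sub>R cscale z x"
    by (simp add: cscale_of_real[symmetric] cscale_cscale mult.commute)
qed (auto simp: cscale_add_right norm_cscale mult.commute)

lemma cscale_zero_right [simp]: "cscale z (0::'a::complex_banach) = 0"
  by (metis norm_cscale norm_eq_zero mult_zero_right)

lemma cscale_zero_left [simp]: "cscale 0 (x::'a::complex_banach) = 0"
  by (metis norm_cscale norm_eq_zero mult_zero_left norm_zero)

lemma cscale_diff_left: "cscale (a - b) x = cscale a x - cscale b (x::'a::complex_banach)"
  by (metis cscale_add_left diff_add_cancel add_diff_cancel_right')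

lemma closed_csubspace_imp_subspace: "closed_csubspace M \<Longrightarrow> subspace M"
  unfolding closed_csubspace_def subspace_def by (metis cscale_of_real)

lemma closed_csubspace_imp_closed: "closed_csubspace M \<Longrightarrow> closed M"
  by (simp add: closed_csubspace_def)

lemma closed_csubspace_cscale: "closed_csubspace M \<Longrightarrow> x \<in> M \<Longrightarrow> cscale c x \<in> M"
  by (simp add: closed_csubspace_def)

lemma closed_csubspace_image:
  assumes "cblinear A" "closed_csubspace V" "closed (A ` V)"
  shows "closed_csubspace (A ` V)"
proof -
  have A: "linear A" using assms(1) by (simp add: cblinear_def bounded_linear.linear)
  have "subspace (A ` V)"
    using A closed_csubspace_imp_subspace[OF assms(2)] linear_subspace_image by blast
  moreover have "cscale c x \<in> A ` V" if "x \<in> A ` V" for c x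
    using that assms(1,2) unfolding cblinear_def closed_csubspace_def by (metis image_iff)
  ultimately show ?thesis
    using assms(3) by (simp add: closed_csubspace_def subspace_0 subspace_add)
qed

lemma cblinear_opshift: "cblinear T \<Longrightarrow> cblinear (opshift T z)"
  unfolding cblinear_def opshift_def
  by (auto intro!: bounded_linear_sub bounded_linear_cscale
      simp: linear_diff[OF bounded_linear.linear[OF bounded_linear_cscale]] cscale_cscale mult.commute)

lemma bounded_linear_opshift: "cblinear T \<Longrightarrow> bounded_linear (opshift T z)"
  using cblinear_opshift cblinear_def by blast

lemma linear_opshift: "cblinear T \<Longrightarrow> linear (opshift T z)"
  using bounded_linear_opshift bounded_linear.linear by blast

lemma opshift_opshift: "opshift (opshift T a) b = opshift T (a + b)"
  by (rule ext) (simp add: opshift_def cscale_add_left)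

lemma opshift_change: "opshift T b x = opshift T a x + cscale (a - b) x"
  by (simp add: opshift_def cscale_diff_left)

lemma opshift_invariant:
  assumes "closed_csubspace Y" "opshift T a ` Y \<subseteq> Y"
  shows "opshift T b ` Y \<subseteq> Y"
proof (rule image_subsetI)
  fix x assume x: "x \<in> Y"
  show "opshift T b x \<in> Y"
    unfolding opshift_change[of T b x a]
    using assms x closed_csubspace_imp_subspace by (intro subspace_add closed_csubspace_cscale) auto
qed

section \<open>Stability of surjectivity and resolvent sets of restrictions\<close>

text \<open>A lift \<open>x\<close> of \<open>y\<close> for the parameter \<open>z\<close> misses
  \<open>y\<close> for the parameter \<open>w\<close> by \<open>cscale (w - z) x\<close>, whose norm
  is at most half that of \<open>y\<close>. Successive approximation with factor 1/2 doubles the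
  constant.\<close>

lemma surjective_lift_perturb:
  assumes T: "cblinear T" and W: "closed_csubspace W" and C: "C > 0"
    and lift: "\<And>y. y \<in> W \<Longrightarrow> \<exists>x\<in>W. opshift T z x = y \<and> norm x \<le> C * norm y"
    and w: "cmod (w - z) * C \<le> 1 / 2" and y: "y \<in> W"
  shows "\<exists>x\<in>W. opshift T w x = y \<and> norm x \<le> 2 * C * norm y"
proof -
  have "\<exists>x\<in>W. norm x \<le> C * norm y \<and> y - opshift T w x \<in> W
      \<and> norm (y - opshift T w x) \<le> 1/2 * norm y" if yW: "y \<in> W" for y
  proof -
    obtain x where x: "x \<in> W" "opshift T z x = y" "norm x \<le> C * norm y" using lift[OF yW] by blast
    have eq: "y - opshift T w x = cscale (w - z) x"
      unfolding x(2)[symmetric] using opshift_change[of T z x w] by simp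
    have "cmod (w - z) * norm x \<le> cmod (w - z) * (C * norm y)"
      using x(3) by (intro mult_left_mono) auto
    also have "\<dots> = (cmod (w - z) * C) * norm y" by simp
    also have "\<dots> \<le> 1/2 * norm y" using w by (intro mult_right_mono) auto
    finally show ?thesis using x eq W by (intro bexI[of _ x]) (auto simp: norm_cscale closed_csubspace_cscale)
  qed
  from successive_approximation[OF bounded_linear_opshift[OF T] closed_csubspace_imp_subspace[OF W]
      closed_csubspace_imp_closed[OF W] _ _ _ this y] C
  show ?thesis by auto
qed

text \<open>All parameters near \<open>z\<close> share one lifting constant. If the operator at
  \<open>a\<close> is injective, a kernel vector \<open>x\<close> at \<open>b\<close> is the only
  lift of its image \<open>cscale (b - a) x\<close>, so the lifting bound would make it shorter than
  itself unless it vanishes. Thus injectivity at one point of the ball spreads to the whole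
  ball.\<close>

lemma surjective_stable:
  assumes T: "cblinear T" and W: "closed_csubspace W" and onto: "opshift T z ` W = W"
  shows "\<exists>d>0. \<forall>a\<in>ball z d. opshift T a ` W = W \<and> (\<forall>b\<in>ball z d.
    (\<forall>x\<in>W. opshift T a x = 0 \<longrightarrow> x = 0) \<longrightarrow> (\<forall>x\<in>W. opshift T b x = 0 \<longrightarrow> x = 0))"
proof -
  note sW = closed_csubspace_imp_subspace[OF W]
  obtain C where C: "C > 0"
    "\<And>y. y \<in> W \<Longrightarrow> \<exists>x\<in>W. opshift T z x = y \<and> norm x \<le> C * norm y"
    using closed_range_lift[OF bounded_linear_opshift[OF T] sW closed_csubspace_imp_closed[OF W], of z]
      onto closed_csubspace_imp_closed[OF W] by auto
  \<comment> \<open>This radius meets the bound 1/2 of the perturbation lemma. It also keeps two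
    points of the ball less than \<open>1 / (2 * C)\<close> apart, which is what the lifting
    constant \<open>2 * C\<close> requires for the contradiction below.\<close>
  define d where "d = 1 / (4 * C)"
  have lift: "\<exists>x\<in>W. opshift T a x = y \<and> norm x \<le> 2 * C * norm y" if "a \<in> ball z d" "y \<in> W" for a y
  proof (rule surjective_lift_perturb[OF T W C(1) C(2) _ that(2)])
    have "cmod (a - z) < d" using that by (simp add: dist_norm norm_minus_commute)
    then have "cmod (a - z) * C \<le> d * C" using C(1) by (intro mult_right_mono) auto
    also have "\<dots> \<le> 1 / 2" using C(1) by (simp add: d_def)
    finally show "cmod (a - z) * C \<le> 1 / 2" .
  qed
  have inv: "opshift T a ` W \<subseteq> W" for a using opshift_invariant[OF W] onto by blast
  show ?thesis
  proof (intro exI[of _ d] conjI ballI impI)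
    show "d > 0" using C(1) by (simp add: d_def)
    show "opshift T a ` W = W" if "a \<in> ball z d" for a
      using inv lift[OF that] by blast
    fix a b x assume ab: "a \<in> ball z d" "b \<in> ball z d" and inj: "\<forall>x\<in>W. opshift T a x = 0 \<longrightarrow> x = 0"
      and xW: "x \<in> W" "opshift T b x = 0"
    show "x = 0"
    proof (rule ccontr)
      assume "x \<noteq> 0"
      note x = xW this
      have eq: "opshift T a x = cscale (b - a) x" using opshift_change[of T a x b] x by simp
      have "opshift T a x \<in> W" using inv x by blast
      then obtain u where u: "u \<in> W" "opshift T a u = opshift T a x"
        "norm u \<le> 2 * C * norm (opshift T a x)"
        using lift[OF ab(1)] by blast
      have "opshift T a (x - u) = 0" using u linear_diff[OF linear_opshift[OF T]] by simp
      then have "x = u" using inj u x sW subspace_diff[of W x u] by auto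
      then have "1 * norm x \<le> (2 * C * cmod (b - a)) * norm x"
        using u(3) eq by (simp add: norm_cscale mult.assoc)
      then have "1 \<le> 2 * C * cmod (b - a)" using x(3) by simp
      moreover have "cmod (b - a) < 2 * d"
        using ab norm_triangle_ineq4[of "b - z" "a - z"] by (simp add: dist_norm norm_minus_commute)
      then have "2 * C * cmod (b - a) < 2 * C * (2 * d)" using C(1) by (intro mult_strict_left_mono) auto
      then have "2 * C * cmod (b - a) < 1" using C(1) by (simp add: d_def)
      ultimately show False by simp
    qed
  qed
qed

definition resolvent_on :: "('a::complex_banach \<Rightarrow> 'a) \<Rightarrow> 'a set \<Rightarrow> complex set" where
  "resolvent_on T Y = {z. bij_betw (opshift T z) Y Y}"

lemma resolvent_on_iff:
  assumes "cblinear T" "closed_csubspace Y"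
  shows "z \<in> resolvent_on T Y \<longleftrightarrow>
    opshift T z ` Y = Y \<and> (\<forall>x\<in>Y. opshift T z x = 0 \<longrightarrow> x = 0)"
  using linear_inj_on_iff_eq_0[OF linear_opshift[OF assms(1)] closed_csubspace_imp_subspace[OF assms(2)]]
  by (auto simp: resolvent_on_def bij_betw_def)

lemma open_resolvent_on:
  assumes T: "cblinear T" and Y: "closed_csubspace Y"
  shows "open (resolvent_on T Y)"
  unfolding open_contains_ball
proof
  fix z assume "z \<in> resolvent_on T Y"
  then have z: "opshift T z ` Y = Y" "\<forall>x\<in>Y. opshift T z x = 0 \<longrightarrow> x = 0"
    using resolvent_on_iff[OF T Y] by auto
  obtain d where d: "d > 0" "\<forall>a\<in>ball z d. opshift T a ` Y = Y \<and> (\<forall>b\<in>ball z d.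
    (\<forall>x\<in>Y. opshift T a x = 0 \<longrightarrow> x = 0) \<longrightarrow> (\<forall>x\<in>Y. opshift T b x = 0 \<longrightarrow> x = 0))"
    using surjective_stable[OF T Y z(1)] by metis
  show "\<exists>e>0. ball z e \<subseteq> resolvent_on T Y"
  proof (intro exI[of _ d] conjI subsetI d(1))
    fix b assume b: "b \<in> ball z d"
    have "z \<in> ball z d" using d(1) by simp
    then show "b \<in> resolvent_on T Y" using d(2) z(2) b unfolding resolvent_on_iff[OF T Y] by blast
  qed
qed

text \<open>Injectivity and closed range make the operator bounded below at \<open>z\<close>. The
  lower bound persists at nearby resolvent points \<open>w\<close>, so the inverses there are
  uniformly bounded, and surjectivity can be carried from \<open>w\<close> back to
  \<open>z\<close>.\<close>

lemma closure_resolvent_onI: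
  assumes T: "cblinear T" and Y: "closed_csubspace Y"
    and cl: "closed (opshift T z ` Y)" and inj: "\<forall>x\<in>Y. opshift T z x = 0 \<longrightarrow> x = 0"
    and z: "z \<in> closure (resolvent_on T Y)"
  shows "z \<in> resolvent_on T Y"
proof -
  note sY = closed_csubspace_imp_subspace[OF Y]
  obtain C where C: "C > 0"
    "\<And>y. y \<in> opshift T z ` Y \<Longrightarrow> \<exists>x\<in>Y. opshift T z x = y \<and> norm x \<le> C * norm y"
    using closed_range_lift[OF bounded_linear_opshift[OF T] sY closed_csubspace_imp_closed[OF Y] cl]
    by blast
  have below: "norm x \<le> C * norm (opshift T z x)" if x: "x \<in> Y" for x
  proof -
    obtain u where u: "u \<in> Y" "opshift T z u = opshift T z x" "norm u \<le> C * norm (opshift T z x)"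
      using C(2) x by blast
    have "opshift T z (x - u) = 0" using u linear_diff[OF linear_opshift[OF T]] by simp
    then have "x = u" using inj u x sY subspace_diff[of Y x u] by auto
    then show ?thesis using u by simp
  qed
  \<comment> \<open>At this distance the lower bound at \<open>z\<close> gives preimages at
    \<open>w\<close> of norm at most \<open>4/3 * C * norm y\<close>, rounded up to
    \<open>2 * C * norm y\<close>. Then \<open>cmod (w - z) * (2 * C)\<close> stays below 1/2, as
    the way back to \<open>z\<close> demands.\<close>
  have "1 / (4 * C) > 0" using C(1) by simp
  then obtain w where w: "w \<in> resolvent_on T Y" "dist w z < 1 / (4 * C)"
    using z unfolding closure_approachable by blast
  have wC: "cmod (w - z) * C < 1 / 4" using w(2) C(1) by (simp add: dist_norm field_simps)
  have onto: "opshift T w ` Y = Y" using w resolvent_on_iff[OF T Y] by blast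
  have lift: "\<exists>x\<in>Y. opshift T w x = y \<and> norm x \<le> 2 * C * norm y" if y: "y \<in> Y" for y
  proof -
    obtain x where x: "x \<in> Y" "opshift T w x = y" using onto y by (metis imageE)
    have "norm x \<le> C * norm (opshift T z x)" using below x by blast
    also have "opshift T z x = y + cscale (w - z) x" using opshift_change[of T z x w] x by simp
    also have "C * norm (y + cscale (w - z) x) \<le> C * (norm y + cmod (w - z) * norm x)"
      using C(1) norm_triangle_ineq[of y "cscale (w - z) x"]
      by (intro mult_left_mono) (auto simp: norm_cscale)
    also have "\<dots> = C * norm y + (cmod (w - z) * C) * norm x" by (simp add: algebra_simps)
    also have "\<dots> \<le> C * norm y + 1 / 4 * norm x"
      using wC by (intro add_left_mono mult_right_mono) auto
    finally have "norm x * (3/4) \<le> C * norm y" by simp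
    then have "norm x \<le> 4/3 * (C * norm y)" by simp
    also have "\<dots> \<le> 2 * (C * norm y)" using C(1) by (intro mult_right_mono) auto
    finally have "norm x \<le> 2 * C * norm y" by simp
    then show ?thesis using x by blast
  qed
  have "\<exists>x\<in>Y. opshift T z x = y" if "y \<in> Y" for y
    using surjective_lift_perturb[OF T Y _ lift _ that, of z] C(1) wC
    by (fastforce simp: norm_minus_commute)
  then have "Y \<subseteq> opshift T z ` Y" by (metis image_eqI subsetI)
  moreover have "opshift T z ` Y \<subseteq> Y" by (rule opshift_invariant[OF Y, of T w]) (simp add: onto)
  ultimately show ?thesis unfolding resolvent_on_iff[OF T Y] using inj by (intro conjI equalityI)
qed

section \<open>Injectivity from the generalized range\<close>

text \<open>On the kernel of \<open>opshift T b\<close> the operator \<open>opshift T z\<close> is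
  multiplication by the nonzero scalar \<open>b - z\<close>, so a multiple of each kernel vector is
  a preimage of it in the same kernel.\<close>

lemma eigenvector_in_gen_range:
  assumes T: "cblinear T" and Y: "closed_csubspace Y" and ne: "b \<noteq> z"
    and x: "x \<in> Y" "opshift T b x = 0"
  shows "x \<in> gen_range (opshift T z) Y"
proof -
  let ?E = "{x \<in> Y. opshift T b x = 0}"
  have "?E \<subseteq> (opshift T z ^^ n) ` Y" for n
  proof (induction n)
    case (Suc n)
    show ?case
    proof
      fix x assume x: "x \<in> ?E"
      have lin: "opshift T a (cscale c x) = cscale c (opshift T a x)" for a c
        using cblinear_opshift[OF T] by (simp add: cblinear_def)
      let ?u = "cscale (1 / (b - z)) x"
      have "?u \<in> ?E" using x Y closed_csubspace_cscale by (auto simp: lin)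
      then have "?u \<in> (opshift T z ^^ n) ` Y" using Suc by blast
      moreover have "opshift T z ?u = x"
        using x opshift_change[of T z x b] ne by (simp add: lin cscale_cscale cscale_one)
      ultimately show "x \<in> (opshift T z ^^ Suc n) ` Y" by (auto simp: image_iff)
    qed
  qed auto
  then show ?thesis using x by (auto simp: gen_range_def)
qed

text \<open>The generalized range is closed and mapped onto itself, so
  \<open>surjective_stable\<close> applies to it. A resolvent point close to \<open>z\<close>
  supplies injectivity somewhere in the ball, hence everywhere in it, including at
  \<open>z\<close>.\<close>

lemma gen_range_injective_near:
  assumes T: "cblinear T" and Y: "closed_csubspace Y" "opshift T z ` Y \<subseteq> Y"
    and cl: "\<And>n. closed ((opshift T z ^^ n) ` Y)"
    and stab: "\<And>m. m \<ge> n0 \<Longrightarrow>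
      {x \<in> (opshift T z ^^ n0) ` Y. opshift T z x = 0} \<subseteq> (opshift T z ^^ m) ` Y"
    and z: "z \<in> closure (resolvent_on T Y)"
  shows "\<exists>d>0. \<forall>b\<in>ball z d. \<forall>x\<in>gen_range (opshift T z) Y. opshift T b x = 0 \<longrightarrow> x = 0"
proof -
  let ?A = "opshift T z" and ?W = "gen_range (opshift T z) Y"
  have cs: "closed_csubspace ((?A ^^ n) ` Y)" for n
  proof (induction n)
    case (Suc n)
    then show ?case
      using closed_csubspace_image[OF cblinear_opshift[OF T] Suc] cl[of "Suc n"] by (simp add: image_comp)
  qed (use Y in simp)
  have W: "closed_csubspace ?W"
    unfolding closed_csubspace_def
  proof (intro conjI ballI allI)
    show "closed ?W" unfolding gen_range_def using cl by (intro closed_INT) auto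
    show "0 \<in> ?W" unfolding gen_range_def
      using cs[THEN closed_csubspace_imp_subspace, THEN subspace_0] by (rule INT_I)
    show "x + y \<in> ?W" if "x \<in> ?W" "y \<in> ?W" for x y
      using that subspace_add[OF closed_csubspace_imp_subspace[OF cs]] by (simp add: gen_range_def)
    show "cscale c x \<in> ?W" if "x \<in> ?W" for c x
      using that closed_csubspace_cscale[OF cs] by (simp add: gen_range_def)
  qed
  have "?A ` ?W = ?W"
    by (rule gen_range_surj[OF linear_opshift[OF T] closed_csubspace_imp_subspace[OF Y(1)] Y(2) stab])
  from surjective_stable[OF T W this] obtain d where d: "d > 0"
    "\<forall>a\<in>ball z d. opshift T a ` ?W = ?W \<and> (\<forall>b\<in>ball z d.
      (\<forall>x\<in>?W. opshift T a x = 0 \<longrightarrow> x = 0) \<longrightarrow> (\<forall>x\<in>?W. opshift T b x = 0 \<longrightarrow> x = 0))"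
    by metis
  obtain a where a: "a \<in> resolvent_on T Y" "dist a z < d"
    using z d(1) unfolding closure_approachable by blast
  have "?W \<subseteq> Y" unfolding gen_range_def using INF_lower[of 0 UNIV "\<lambda>n. (?A ^^ n) ` Y"] by simp
  then have "\<forall>x\<in>?W. opshift T a x = 0 \<longrightarrow> x = 0"
    using a resolvent_on_iff[OF T Y(1)] by blast
  moreover have "a \<in> ball z d" using a(2) by (simp add: dist_commute)
  ultimately show ?thesis using d by blast
qed

text \<open>The Kato condition puts the whole kernel into the generalized range, so injectivity
  there at \<open>z\<close> is injectivity on \<open>Y\<close>. Together with the closed range this
  admits \<open>closure_resolvent_onI\<close>.\<close>

lemma kato_on_resolvent:
  assumes T: "cblinear T" and Y: "closed_csubspace Y" "opshift T z ` Y \<subseteq> Y"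
    and kato: "kato_on (opshift T z) Y" and z: "z \<in> closure (resolvent_on T Y)"
  shows "z \<in> resolvent_on T Y"
proof -
  let ?A = "opshift T z"
  have ker: "{x\<in>Y. ?A x = 0} \<subseteq> (?A ^^ n) ` Y" for n using kato by (simp add: kato_on_def)
  have clA: "closed (?A ` Y)" using kato by (simp add: kato_on_def)
  have sub: "(?A ^^ n) ` Y \<subseteq> Y" for n using funpow_image_antimono[OF Y(2), of 0 n] by simp
  have cs: "closed_csubspace ((?A ^^ n) ` Y)" for n
  proof (induction n)
    case (Suc n)
    \<comment> \<open>Every range contains the kernel of \<open>?A\<close>, so its image is closed
      again.\<close>
    have "closed (?A ` (?A ^^ n) ` Y)"
      by (rule closed_image_closed_subspace[OF bounded_linear_opshift[OF T] _ _ clA _ _ sub ker])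
        (use Y Suc closed_csubspace_imp_subspace closed_csubspace_imp_closed in auto)
    from closed_csubspace_image[OF cblinear_opshift[OF T] Suc this]
    show ?case by (simp add: image_comp)
  qed (use Y in simp)
  have "\<exists>d>0. \<forall>b\<in>ball z d. \<forall>x\<in>gen_range ?A Y. opshift T b x = 0 \<longrightarrow> x = 0"
  proof (rule gen_range_injective_near[OF T Y _ _ z, of 0])
    show "closed ((?A ^^ n) ` Y)" for n using cs closed_csubspace_imp_closed by blast
    show "{x \<in> (?A ^^ 0) ` Y. ?A x = 0} \<subseteq> (?A ^^ m) ` Y" for m using ker by simp
  qed
  then have "\<forall>x\<in>gen_range ?A Y. ?A x = 0 \<longrightarrow> x = 0" by (meson centre_in_ball)
  then have "\<forall>x\<in>Y. ?A x = 0 \<longrightarrow> x = 0"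
    using ker by (auto simp: gen_range_def)
  then show ?thesis by (rule closure_resolvent_onI[OF T Y(1) clA _ z])
qed

text \<open>The complex span of \<open>F\<close> lies in the real span of \<open>F\<close> and its
  multiples by \<open>\<i>\<close>. This links complex finite dimension to \<open>span\<close> and
  \<open>independent\<close>, which are real notions.\<close>

lemma fin_dim_c_real_span:
  assumes "fin_dim_c K" "\<And>c x. x \<in> K \<Longrightarrow> cscale c x \<in> K"
  shows "\<exists>F. finite F \<and> F \<subseteq> K \<and> K \<subseteq> span F"
proof -
  obtain F where F: "finite F" "F \<subseteq> K" "K \<subseteq> cspan F" using assms(1) unfolding fin_dim_c_def by blast
  let ?F = "F \<union> cscale \<i> ` F"
  have "cspan F \<subseteq> span ?F"
  proof
    fix x assume "x \<in> cspan F"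
    then obtain G c where G: "G \<subseteq> F" "x = (\<Sum>v\<in>G. cscale (c v) v)" by (auto simp: cspan_def)
    have "cscale (c v) v \<in> span ?F" if "v \<in> F" for v
    proof -
      have "cscale (c v) v = cscale (of_real (Re (c v)) + of_real (Im (c v)) * \<i>) v"
        by (metis complex_eq mult.commute)
      also have "\<dots> = Re (c v) *\<^sub>R v + Im (c v) *\<^sub>R cscale \<i> v"
        by (simp only: cscale_add_left cscale_cscale[symmetric] cscale_of_real)
      also have "\<dots> \<in> span ?F" using that by (intro span_add span_scale span_base) auto
      finally show ?thesis .
    qed
    then show "x \<in> span ?F" using G by (auto intro!: span_sum)
  qed
  then have "K \<subseteq> span ?F" using F by blast
  moreover have "?F \<subseteq> K" using F assms(2) by auto
  ultimately show ?thesis using F(1) by (intro exI[of _ ?F]) simp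
qed

text \<open>The kernel may now stick out of the ranges, but it is finite-dimensional. Adjoining it
  to a subspace keeps closedness and does not change the image, which yields closed ranges of all
  powers; its intersections with these ranges stabilize, which yields surjectivity on the
  generalized range.\<close>

lemma fredholm_on_injective_near:
  assumes T: "cblinear T" and Y: "closed_csubspace Y" "opshift T z ` Y \<subseteq> Y"
    and fredholm: "fredholm_on (opshift T z) Y" and z: "z \<in> closure (resolvent_on T Y)"
  shows "\<exists>d>0. \<forall>b\<in>ball z d - {z}. \<forall>x\<in>Y. opshift T b x = 0 \<longrightarrow> x = 0"
proof -
  let ?A = "opshift T z"
  let ?K = "{x\<in>Y. ?A x = 0}"
  note sY = closed_csubspace_imp_subspace[OF Y(1)]
  have clA: "closed (?A ` Y)" and fd: "fin_dim_c ?K" using fredholm by (auto simp: fredholm_on_def)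
  have "cscale c x \<in> ?K" if "x \<in> ?K" for c x
    using that cblinear_opshift[OF T] Y(1) by (simp add: cblinear_def closed_csubspace_cscale)
  then obtain F where F: "finite F" "F \<subseteq> ?K" "?K \<subseteq> span F"
    using fin_dim_c_real_span[OF fd] by blast
  have sub: "(?A ^^ n) ` Y \<subseteq> Y" for n using funpow_image_antimono[OF Y(2), of 0 n] by simp
  have kerA: "subspace {x. ?A x = 0}" using linear_opshift[OF T] by (rule linear_subspace_kernel)
  have cl: "closed (?A ` V)" if V: "closed_csubspace V" "V \<subseteq> Y" for V
  proof -
    note sV = closed_csubspace_imp_subspace[OF V(1)]
    have "closed (?A ` span (V \<union> F))"
    proof (rule closed_image_closed_subspace[OF bounded_linear_opshift[OF T] sY
          closed_csubspace_imp_closed[OF Y(1)] clA subspace_span])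
      show "closed (span (V \<union> F))"
        using closed_span_Un_finite[OF F(1) sV closed_csubspace_imp_closed[OF V(1)]] .
      show "span (V \<union> F) \<subseteq> Y" using V F sY by (intro span_minimal) auto
      show "?K \<subseteq> span (V \<union> F)" using F span_mono[of F "V \<union> F"] by blast
    qed
    also have "?A ` span (V \<union> F) = ?A ` V"
    proof
      show "?A ` span (V \<union> F) \<subseteq> ?A ` V"
      proof
        fix y assume "y \<in> ?A ` span (V \<union> F)"
        then obtain v k where vk: "v \<in> span V" "k \<in> span F" "y = ?A (v + k)"
          by (auto simp: span_Un)
        have "k \<in> {x. ?A x = 0}" using vk(2) span_minimal[OF _ kerA, of F] F(2) by blast
        then have "y = ?A v" using vk linear_add[OF linear_opshift[OF T]] by simp
        then show "y \<in> ?A ` V" using vk sV by (metis image_eqI span_eq_iff)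
      qed
      show "?A ` V \<subseteq> ?A ` span (V \<union> F)" by (auto intro!: imageI span_base)
    qed
    finally show ?thesis .
  qed
  have cs: "closed_csubspace ((?A ^^ n) ` Y)" for n
  proof (induction n)
    case (Suc n)
    from closed_csubspace_image[OF cblinear_opshift[OF T] Suc cl[OF Suc sub]]
    show ?case by (simp add: image_comp)
  qed (use Y in simp)
  have "\<exists>n0. \<forall>m\<ge>n0. (?A ^^ n0) ` Y \<inter> {x. ?A x = 0} \<subseteq> (?A ^^ m) ` Y \<inter> {x. ?A x = 0}"
  proof (rule decreasing_subspaces_stabilize[OF _ _ F(1)])
    show "subspace ((?A ^^ n) ` Y \<inter> {x. ?A x = 0})" for n
      using cs closed_csubspace_imp_subspace kerA subspace_inter by blast
    show "(?A ^^ n) ` Y \<inter> {x. ?A x = 0} \<subseteq> (?A ^^ m) ` Y \<inter> {x. ?A x = 0}" if "m \<le> n" for m n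
      using funpow_image_antimono[OF Y(2) that] by blast
    show "(?A ^^ 0) ` Y \<inter> {x. ?A x = 0} \<subseteq> span F" using F by auto
  qed
  then obtain n0 where n0: "\<And>m. m \<ge> n0 \<Longrightarrow> {x \<in> (?A ^^ n0) ` Y. ?A x = 0} \<subseteq> (?A ^^ m) ` Y"
    by blast
  have "\<exists>d>0. \<forall>b\<in>ball z d. \<forall>x\<in>gen_range ?A Y. opshift T b x = 0 \<longrightarrow> x = 0"
    by (rule gen_range_injective_near[OF T Y closed_csubspace_imp_closed[OF cs] n0 z])
  \<comment> \<open>Only for \<open>b\<close> different from \<open>z\<close> is the kernel known to
    lie in the generalized range, hence the punctured ball.\<close>
  then show ?thesis using eigenvector_in_gen_range[OF T Y(1)] by (metis DiffD1 DiffD2 insertI1)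
qed

section \<open>Boundary points of the spectrum\<close>

text \<open>A punctured disc in the plane is connected. Around a frontier point that is not isolated
  in \<open>S\<close> it meets both \<open>S\<close> and its complement, hence the frontier.\<close>

lemma frontier_islimpt_frontier:
  fixes S :: "complex set"
  assumes z: "z \<in> frontier S" "z islimpt S" and r: "r > 0"
    and cl: "closed S"
  obtains w where "w \<in> frontier S" "w \<noteq> z" "dist w z < r"
proof -
  let ?B = "ball z r - {z}"
  have "connected ?B" by (rule connected_punctured_ball) simp
  moreover have "?B \<inter> S \<noteq> {}" using z(2) r unfolding islimpt_approachable
    by (metis DiffI Int_iff dist_commute empty_iff mem_ball singletonD)
  moreover have "?B - S \<noteq> {}"
  proof -
    have "z \<in> S" using z(1) cl frontier_subset_closed by blast
    moreover have "z \<in> closure (- S)" using z(1) by (simp add: frontier_closures)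
    ultimately obtain y where "y \<notin> S" "dist y z < r" "y \<noteq> z"
      using r unfolding closure_approachable by (metis ComplD)
    then have "y \<in> ?B - S" by (simp add: dist_commute)
    then show ?thesis by blast
  qed
  ultimately have "?B \<inter> frontier S \<noteq> {}" by (rule connected_Int_frontier)
  then obtain w where "w \<in> ?B" "w \<in> frontier S" by blast
  then show ?thesis using that[of w] by (auto simp: dist_commute)
qed

text \<open>A pair that reduces one shift of \<open>T\<close> reduces every shift, and by uniqueness
  of components injectivity and surjectivity can be checked on each summand.\<close>

lemma resolvent_on_reducing_pair:
  assumes T: "cblinear T" and MN: "reducing_pair (opshift T a) M N"
  shows "resolvent_on T UNIV = resolvent_on T M \<inter> resolvent_on T N"
proof -
  have M: "closed_csubspace M" and N: "closed_csubspace N" and int: "M \<inter> N = {0}"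
    and dec: "\<And>x. \<exists>m\<in>M. \<exists>n\<in>N. x = m + n"
    and inv0: "opshift T a ` M \<subseteq> M" "opshift T a ` N \<subseteq> N"
    using MN by (auto simp: reducing_pair_def)
  note sM = closed_csubspace_imp_subspace[OF M] and sN = closed_csubspace_imp_subspace[OF N]
  have U: "closed_csubspace (UNIV :: 'a set)" by (simp add: closed_csubspace_def)
  have uniq: "m = m' \<and> n = n'" if "m \<in> M" "m' \<in> M" "n \<in> N" "n' \<in> N" "m + n = m' + n'" for m m' n n'
  proof -
    have "m - m' = n' - n" using that(5) by (simp add: algebra_simps)
    then have "m - m' \<in> M \<inter> N" using that sM sN by (metis IntI subspace_diff)
    then show ?thesis using int \<open>m - m' = n' - n\<close> by auto
  qed
  have 0: "0 \<in> M" "0 \<in> N" using sM sN subspace_0 by auto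
  have "z \<in> resolvent_on T UNIV \<longleftrightarrow> z \<in> resolvent_on T M \<and> z \<in> resolvent_on T N" for z
  proof -
    let ?A = "opshift T z"
    have inv: "?A ` M \<subseteq> M" "?A ` N \<subseteq> N"
      using opshift_invariant[OF M inv0(1)] opshift_invariant[OF N inv0(2)] by auto
    have add: "?A (x + y) = ?A x + ?A y" for x y using linear_add[OF linear_opshift[OF T]] .
    show ?thesis
      unfolding resolvent_on_iff[OF T U] resolvent_on_iff[OF T M] resolvent_on_iff[OF T N]
    proof (intro iffI conjI)
      assume L: "range ?A = UNIV \<and> (\<forall>x\<in>UNIV. ?A x = 0 \<longrightarrow> x = 0)"
      then show "\<forall>x\<in>M. ?A x = 0 \<longrightarrow> x = 0" "\<forall>x\<in>N. ?A x = 0 \<longrightarrow> x = 0" by auto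
      have *: "\<exists>m\<in>M. \<exists>n\<in>N. y = ?A m + ?A n" for y
      proof -
        obtain x where "y = ?A x" using L by (metis surjD)
        then show ?thesis using dec[of x] add by auto
      qed
      show "?A ` M = M"
      proof
        show "M \<subseteq> ?A ` M"
        proof
          fix y assume y: "y \<in> M"
          obtain m n where mn: "m \<in> M" "n \<in> N" "y = ?A m + ?A n" using * by blast
          then have "?A m = y" using uniq[of y "?A m" 0 "?A n"] y inv 0 by auto
          then show "y \<in> ?A ` M" using mn by blast
        qed
      qed (use inv in auto)
      show "?A ` N = N"
      proof
        show "N \<subseteq> ?A ` N"
        proof
          fix y assume y: "y \<in> N"
          obtain m n where mn: "m \<in> M" "n \<in> N" "y = ?A m + ?A n" using * by blast
          then have "?A n = y" using uniq[of 0 "?A m" y "?A n"] y inv 0 by auto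
          then show "y \<in> ?A ` N" using mn by blast
        qed
      qed (use inv in auto)
    next
      assume R: "(?A ` M = M \<and> (\<forall>x\<in>M. ?A x = 0 \<longrightarrow> x = 0)) \<and>
        ?A ` N = N \<and> (\<forall>x\<in>N. ?A x = 0 \<longrightarrow> x = 0)"
      have "y \<in> range ?A" for y
      proof -
        obtain m n where "m \<in> M" "n \<in> N" "y = m + n" using dec by blast
        moreover from this obtain u v where "m = ?A u" "n = ?A v" using R by (metis imageE)
        ultimately show ?thesis using add by (metis rangeI)
      qed
      then show "range ?A = UNIV" by blast
      show "\<forall>x\<in>UNIV. ?A x = 0 \<longrightarrow> x = 0"
      proof (intro ballI impI)
        fix x assume x: "?A x = 0"
        obtain m n where mn: "m \<in> M" "n \<in> N" "x = m + n" using dec by blast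
        have "?A m \<in> M" "?A n \<in> N" using inv mn by auto
        moreover have "?A m + ?A n = 0 + 0" using x add mn by simp
        ultimately have "?A m = 0 \<and> ?A n = 0" using uniq 0 by blast
        then show "x = 0" using R mn by auto
      qed
    qed
  qed
  then show ?thesis by blast
qed

lemma cspectrum_eq: "cspectrum T = - resolvent_on T UNIV"
  by (auto simp: cspectrum_def resolvent_on_def)

lemma frontier_not_admits_GKRD:
  assumes T: "cblinear T" and l: "l \<in> frontier (cspectrum T)"
    and lim: "\<forall>z\<in>frontier (cspectrum T). z islimpt cspectrum T"
  shows "\<not> admits_GKRD (opshift T l)"
proof
  assume "admits_GKRD (opshift T l)"
  then obtain M N where MN: "reducing_pair (opshift T l) M N"
    and kato: "kato_on (opshift T l) M" and riesz: "riesz_on (opshift T l) N"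
    by (auto simp: admits_GKRD_def)
  have M: "closed_csubspace M" "opshift T l ` M \<subseteq> M" and N: "closed_csubspace N" "opshift T l ` N \<subseteq> N"
    using MN by (auto simp: reducing_pair_def)
  have U: "closed_csubspace (UNIV :: 'a set)" by (simp add: closed_csubspace_def)
  note res = resolvent_on_reducing_pair[OF T MN]
  have closed: "closed (cspectrum T)"
    unfolding cspectrum_eq using open_resolvent_on[OF T U] by blast
  have front: "z \<in> closure (resolvent_on T M)" "z \<in> closure (resolvent_on T N)"
    "z \<notin> resolvent_on T UNIV" if "z \<in> frontier (cspectrum T)" for z
  proof -
    have "z \<in> closure (resolvent_on T UNIV)" using that by (simp add: cspectrum_eq frontier_closures)
    then show "z \<in> closure (resolvent_on T M)" "z \<in> closure (resolvent_on T N)"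
      using closure_mono[of "resolvent_on T UNIV"] unfolding res by blast+
    show "z \<notin> resolvent_on T UNIV"
      using that frontier_subset_closed[OF closed] unfolding cspectrum_eq by blast
  qed
  \<comment> \<open>Shifting \<open>T - l\<close> by \<open>z - l\<close> gives
    \<open>T - z\<close>, so the Riesz condition covers every point but \<open>l\<close>.\<close>
  have fredholm: "fredholm_on (opshift T z) N" if "z \<noteq> l" for z
    using riesz[unfolded riesz_on_def, rule_format, of "z - l"] that by (simp add: opshift_opshift)
  have "l \<in> resolvent_on T M" using kato_on_resolvent[OF T M kato front(1)[OF l]] .
  then obtain e where e: "e > 0" "ball l e \<subseteq> resolvent_on T M"
    using open_resolvent_on[OF T M(1)] by (auto simp: open_contains_ball)
  \<comment> \<open>At \<open>l\<close> the part on \<open>N\<close> may fail to be Fredholm, which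
    forces the move to \<open>u\<close>. Since injectivity then comes only at points other than
    \<open>u\<close>, a second move to \<open>v\<close> follows.\<close>
  obtain u where u: "u \<in> frontier (cspectrum T)" "u \<noteq> l" "dist u l < e"
    using frontier_islimpt_frontier[OF l _ e(1) closed] lim l by metis
  obtain d where d: "d > 0"
    "\<forall>b\<in>ball u d - {u}. \<forall>x\<in>N. opshift T b x = 0 \<longrightarrow> x = 0"
    using fredholm_on_injective_near[OF T N(1) opshift_invariant[OF N] fredholm[OF u(2)]
          front(2)[OF u(1)]] by metis
  \<comment> \<open>The three bounds keep \<open>v\<close> in the ball of injectivity around
    \<open>u\<close>, apart from \<open>l\<close>, and in the ball around \<open>l\<close> where the
    part on \<open>M\<close> is invertible.\<close>
  define r where "r = min d (min (dist u l) (e - dist u l))"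
  have "r > 0" using d(1) u by (simp add: r_def)
  then obtain v where v: "v \<in> frontier (cspectrum T)" "v \<noteq> u" "dist v u < r"
    using frontier_islimpt_frontier[OF u(1) _ _ closed] lim u(1) by metis
  have vl: "v \<noteq> l" using v(3) by (auto simp: r_def dist_commute)
  have "dist v l < e" using v(3) dist_triangle[of v l u] by (auto simp: r_def)
  then have "v \<in> resolvent_on T M" using e(2) by (auto simp: dist_commute)
  moreover have "v \<in> resolvent_on T N"
  proof (rule closure_resolvent_onI[OF T N(1) _ _ front(2)[OF v(1)]])
    show "closed (opshift T v ` N)" using fredholm[OF vl] by (simp add: fredholm_on_def)
    show "\<forall>x\<in>N. opshift T v x = 0 \<longrightarrow> x = 0" using d(2) v by (auto simp: r_def dist_commute)
  qed
  ultimately show False using front(3)[OF v(1)] res by blast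
qed

section \<open>Comparison of the spectra\<close>

lemma fin_dim_c_zero: "fin_dim_c {0 :: 'a::complex_banach}"
  unfolding fin_dim_c_def cspan_def by (intro exI[of _ "{}"]) auto

lemma quasinilpotent_on_imp_riesz_on:
  assumes "cblinear S" "closed_csubspace N" "quasinilpotent_on S N"
  shows "riesz_on S N"
  unfolding riesz_on_def
proof (intro allI impI)
  fix z :: complex assume "z \<noteq> 0"
  then have "z \<in> resolvent_on S N" using assms(3) by (simp add: quasinilpotent_on_def resolvent_on_def)
  then have z: "opshift S z ` N = N" "\<forall>x\<in>N. opshift S z x = 0 \<longrightarrow> x = 0"
    using resolvent_on_iff[OF assms(1,2)] by auto
  have "0 \<in> N" "closed N" using assms(2) by (auto simp: closed_csubspace_def)
  then have "{x \<in> N. opshift S z x = 0} = {0}"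
    using z(2) linear_0[OF linear_opshift[OF assms(1)]] by auto
  moreover note fin_dim_c_zero
  moreover have "cspan {} = {0 :: 'a}" by (auto simp: cspan_def)
  then have "N = {y + opshift S z w |y w. y \<in> cspan {} \<and> w \<in> N}" using z(1) by auto
  ultimately show "fredholm_on (opshift S z) N"
    unfolding fredholm_on_def using z(1) \<open>closed N\<close> by (intro conjI exI[of _ "{}"]) auto
qed

text \<open>An eigenvector for a nonzero \<open>z\<close> lies in the range of every power of
  \<open>S\<close>, hence is zero. Surjectivity goes by induction on the power of \<open>S\<close>
  that kills \<open>y\<close>.\<close>

lemma nilpotent_on_imp_quasinilpotent_on:
  assumes S: "cblinear S" and N: "closed_csubspace N" "S ` N \<subseteq> N" and nil: "nilpotent_on S N"
  shows "quasinilpotent_on S N"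
  unfolding quasinilpotent_on_def
proof (intro allI impI)
  fix z :: complex assume z: "z \<noteq> 0"
  obtain n where n: "\<And>x. x \<in> N \<Longrightarrow> (S ^^ n) x = 0" using nil by (auto simp: nilpotent_on_def)
  note sN = closed_csubspace_imp_subspace[OF N(1)]
  have S0: "opshift S 0 = S" by (simp add: opshift_def)
  have invz: "opshift S z ` N \<subseteq> N" using opshift_invariant[of N S 0 z] N S0 by simp
  have ker: "x = 0" if "x \<in> N" "opshift S z x = 0" for x
  proof -
    have "x \<in> (S ^^ n) ` N"
      using eigenvector_in_gen_range[OF S N(1) z that] unfolding S0 gen_range_def by blast
    then show ?thesis using n by auto
  qed
  have onto: "y \<in> opshift S z ` N" if "y \<in> N" "(S ^^ k) y = 0" for k y
    using that
  proof (induction k arbitrary: y)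
    case 0
    then show ?case
      using subspace_0[OF sN] linear_0[OF linear_opshift[OF S]] by (auto intro!: image_eqI[of _ _ 0])
  next
    case (Suc k)
    have "S y \<in> N" "(S ^^ k) (S y) = 0" using Suc N by (auto simp: funpow_swap1)
    then obtain x where x: "x \<in> N" "S y = opshift S z x" using Suc.IH by blast
    \<comment> \<open>From \<open>S y = opshift S z x\<close> it follows that
      \<open>opshift S z (x - y) = cscale z y\<close>, and dividing by \<open>z\<close> gives a
      preimage of \<open>y\<close>.\<close>
    let ?u = "cscale (1 / z) (x - y)"
    have uN: "?u \<in> N" using x Suc sN N by (intro closed_csubspace_cscale subspace_diff)
    have "opshift S z (x - y) = cscale z y"
      using x linear_diff[OF linear_opshift[OF S]] by (simp add: opshift_def)
    moreover have "opshift S z ?u = cscale (1 / z) (opshift S z (x - y))"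
      using cblinear_opshift[OF S] by (simp add: cblinear_def)
    ultimately have "opshift S z ?u = y" using z by (simp add: cscale_cscale cscale_one)
    with uN show ?case by (metis imageI)
  qed
  have "z \<in> resolvent_on S N"
    unfolding resolvent_on_iff[OF S N(1)] using invz ker onto n by blast
  then show "bij_betw (opshift S z) N N" by (simp add: resolvent_on_def)
qed

lemma surjective_on_imp_kato_on:
  assumes "closed_csubspace M" "surjective_on S M"
  shows "kato_on S M"
proof -
  have "(S ^^ n) ` M = M" for n
  proof (induction n)
    case (Suc n)
    have "(S ^^ Suc n) ` M = S ` (S ^^ n) ` M" by (simp add: image_comp)
    then show ?case using Suc assms by (simp only: surjective_on_def)
  qed simp
  then show ?thesis
    using assms by (auto simp: kato_on_def surjective_on_def closed_csubspace_def)
qed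

lemma closed_csubspace_zero: "closed_csubspace {0 :: 'a::complex_banach}"
  by (simp add: closed_csubspace_def)

text \<open>The trivial decomposition turns a property of \<open>S\<close> on the whole space into a
  decomposition whose second part is nilpotent.\<close>

lemma reducing_pair_UNIV_zero:
  assumes "cblinear S"
  shows "reducing_pair S UNIV {0}"
proof -
  have "S 0 = 0" using assms by (simp add: cblinear_def linear_0 bounded_linear.linear)
  then show ?thesis
    by (auto simp: reducing_pair_def closed_csubspace_def)
qed

lemma nilpotent_on_zero: "cblinear S \<Longrightarrow> nilpotent_on S {0}"
  unfolding nilpotent_on_def by (intro exI[of _ 1]) (simp add: cblinear_def linear_0 bounded_linear.linear)

lemma is_kato_imp_essentially_kato: "cblinear S \<Longrightarrow> is_kato S \<Longrightarrow> essentially_kato S"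
  unfolding is_kato_def essentially_kato_def
  using reducing_pair_UNIV_zero fin_dim_c_zero nilpotent_on_zero by blast

lemma essentially_kato_imp_kato_type: "essentially_kato S \<Longrightarrow> kato_type S"
  unfolding essentially_kato_def kato_type_def by blast

lemma kato_type_imp_admits_GKD: "cblinear S \<Longrightarrow> kato_type S \<Longrightarrow> admits_GKD S"
  unfolding kato_type_def admits_GKD_def reducing_pair_def
  using nilpotent_on_imp_quasinilpotent_on by blast

lemma admits_GKD_imp_admits_GKRD: "cblinear S \<Longrightarrow> admits_GKD S \<Longrightarrow> admits_GKRD S"
  unfolding admits_GKD_def admits_GKRD_def reducing_pair_def
  using quasinilpotent_on_imp_riesz_on by blast

lemma admits_gDRQ_imp_admits_GKRD: "admits_gDRQ S \<Longrightarrow> admits_GKRD S"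
  unfolding admits_gDRQ_def admits_GKRD_def reducing_pair_def
  using surjective_on_imp_kato_on by blast

lemma surjective_imp_is_kato: "range S = UNIV \<Longrightarrow> is_kato S"
  unfolding is_kato_def
  by (rule surjective_on_imp_kato_on) (auto simp: surjective_on_def closed_csubspace_def)

lemma surjective_imp_admits_gDRQ:
  assumes "cblinear S" "range S = UNIV"
  shows "admits_gDRQ S"
proof -
  have "riesz_on S {0}"
    by (intro quasinilpotent_on_imp_riesz_on[OF assms(1) closed_csubspace_zero]
        nilpotent_on_imp_quasinilpotent_on[OF assms(1) closed_csubspace_zero] nilpotent_on_zero assms(1))
      (use reducing_pair_UNIV_zero[OF assms(1)] in \<open>simp add: reducing_pair_def\<close>)
  then show ?thesis
    unfolding admits_gDRQ_def surjective_on_def using reducing_pair_UNIV_zero assms by blast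
qed

theorem theorem3p23:
  fixes T :: "'a::complex_banach \<Rightarrow> 'a"
  assumes "\<not> fin_dim_c (UNIV :: 'a set)"
    and "cblinear T"
    and "sigma_su T = frontier (cspectrum T)"
    and "\<forall>z\<in>frontier (cspectrum T). z islimpt cspectrum T"
  shows "sigma_ec T \<subseteq> sigma_su T \<and> sigma_su T = sigma_gKR T \<and> sigma_gKR T = sigma_gK T
    \<and> sigma_gK T = sigma_Kt T \<and> sigma_Kt T = sigma_eK T \<and> sigma_eK T = sigma_K T
    \<and> sigma_K T = sigma_gDRQ T"
proof -
  note S = cblinear_opshift[OF assms(2)]
  \<comment> \<open>The inclusions form two cycles through \<open>sigma_su T\<close> and
    \<open>sigma_gKR T\<close>: one returns by way of \<open>sigma_gK\<close>,
    \<open>sigma_Kt\<close>, \<open>sigma_eK\<close> and \<open>sigma_K\<close>, the other by way of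
    \<open>sigma_gDRQ\<close>.\<close>
  have "sigma_su T \<subseteq> sigma_gKR T"
    unfolding assms(3) sigma_gKR_def using frontier_not_admits_GKRD[OF assms(2) _ assms(4)] by blast
  moreover have "sigma_gKR T \<subseteq> sigma_gK T"
    unfolding sigma_gKR_def sigma_gK_def using admits_GKD_imp_admits_GKRD[OF S] by blast
  moreover have "sigma_gK T \<subseteq> sigma_Kt T"
    unfolding sigma_gK_def sigma_Kt_def using kato_type_imp_admits_GKD[OF S] by blast
  moreover have "sigma_Kt T \<subseteq> sigma_eK T"
    unfolding sigma_Kt_def sigma_eK_def using essentially_kato_imp_kato_type by blast
  moreover have "sigma_eK T \<subseteq> sigma_K T"
    unfolding sigma_eK_def sigma_K_def using is_kato_imp_essentially_kato[OF S] by blast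
  moreover have "sigma_K T \<subseteq> sigma_su T"
    unfolding sigma_K_def sigma_su_def using surjective_imp_is_kato by blast
  moreover have "sigma_gKR T \<subseteq> sigma_gDRQ T"
    unfolding sigma_gKR_def sigma_gDRQ_def using admits_gDRQ_imp_admits_GKRD by blast
  moreover have "sigma_gDRQ T \<subseteq> sigma_su T"
    unfolding sigma_gDRQ_def sigma_su_def using surjective_imp_admits_gDRQ[OF S] by blast
  moreover have "sigma_ec T \<subseteq> sigma_su T"
    unfolding sigma_ec_def sigma_su_def by auto
  ultimately show ?thesis by blast
qed

end
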